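(* Let $H$ be an infinite-dimensional complex Hilbert space, let $\Omega\subset H$ be open, and let $u\in\mathcal{PSH}(\Omega)\cap C^2(\Omega)$. Assume that for every bounded open set $G\Subset\Omega$, the family $\{D'D''u(z):z\in G\}$ is collectively compact, that is, the set \[ \{D'D''u(z)h:\ z\in G,\ h\in H,\ \|h\|\le1\} \] is relatively compact in $H$. Then $u$ is maximal in $\Omega$.
   Context: The inner product of $H$ is linear in the first variable. Plurisubharmonic: for $\Omega\subset H$ open, $\mathcal{PSH}(\Omega)$ is the set of upper semicontinuous $u:\Omega\to[-\infty,\infty)$, not identically $-\infty$ on any component of $\Omega$, such that $u(z)\le\frac1{2\pi}\int_0^{2\pi}u(z+e^{i\theta}h)\,d\theta$ whenever $z\in\Omega$, $h\in H$ and $z+\lambda h\in\Omega$ for all $|\lambda|\le1$. Levi form: for $u\in C^2(\Omega)$ with second real Fréchet differential $D^2u(a)$, $4D'D''u(a)(s,t)=D^2u(a)(s,t)+D^2u(a)(is,it)+iD^2u(a)(s,it)-iD^2u(a)(is,t)$; this form is identified with the bounded operator $D'D''u(a)$ on $H$ given by $\langle D'D''u(a)s,t\rangle=D'D''u(a)(s,t)$ (so $D'D''\|z\|^2=I$). For $u$ plurisubharmonic this operator is positive. Maximal: $G\Subset\Omega$ means $G$ is a bounded open set with $\overline G\subset\Omega$ (no compactness of $\overline G$). $u\in\mathcal{PSH}(\Omega)$ is maximal in $\Omega$ if for every bounded open $G\Subset\Omega$ and every $v\in\mathcal{PSH}(G)$ with $\limsup_{z\to\xi}v(z)\le u(\xi)$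 for all $\xi\in\partial G$, one has $v\le u$ on $G$. *)

theory Defs
  imports "HOL-Analysis.Analysis"
begin

text \<open>
  Complex Hilbert spaces. The real inner product, norm and topology of the type are those of the
  underlying real Hilbert space, whose inner product is the real part of the complex one; the
  latter is linear in its first argument.
\<close>

class complex_hilbert_space = real_inner + complete_space +
  fixes scaleC :: "complex \<Rightarrow> 'a \<Rightarrow> 'a" (infixr "*\<^sub>C" 75)
    and cinner :: "'a \<Rightarrow> 'a \<Rightarrow> complex"
  assumes scaleC_add_right: "c *\<^sub>C (x + y) = c *\<^sub>C x + c *\<^sub>C y"
    and scaleC_add_left: "(c + d) *\<^sub>C x = c *\<^sub>C x + d *\<^sub>C x"
    and scaleC_scaleC: "c *\<^sub>C (d *\<^sub>C x) = (c * d) *\<^sub>C x"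
    and scaleC_of_real: "complex_of_real r *\<^sub>C x = r *\<^sub>R x"
    and cinner_add_left: "cinner (x + y) z = cinner x z + cinner y z"
    and cinner_scaleC_left: "cinner (c *\<^sub>C x) y = c * cinner x y"
    and cinner_commute: "cinner x y = cnj (cinner y x)"
    and Re_cinner: "Re (cinner x y) = x \<bullet> y"

lemma scaleC_one: "1 *\<^sub>C x = (x :: 'a::complex_hilbert_space)"
  using scaleC_of_real[of 1 x] by simp

global_interpretation complex_vector:
  vector_space "scaleC :: complex \<Rightarrow> 'a \<Rightarrow> 'a::complex_hilbert_space"
  by standard (simp_all add: scaleC_add_right scaleC_add_left scaleC_scaleC scaleC_one)

text \<open>
  Integral of an extended real valued function, as the difference of the integrals of its positive
  and negative parts (\<^const>\<open>e2ennreal\<close> sends negative arguments to 0). It is only used where the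
  first term is finite, so that the value lies in \<open>[-\<infinity>,\<infinity>)\<close> and \<open>\<infinity> - \<infinity>\<close> does not occur.
\<close>

definition ereal_integral :: "'a measure \<Rightarrow> ('a \<Rightarrow> ereal) \<Rightarrow> ereal" where
  "ereal_integral M f =
     enn2ereal (\<integral>\<^sup>+x. e2ennreal (f x) \<partial>M) - enn2ereal (\<integral>\<^sup>+x. e2ennreal (- f x) \<partial>M)"

definition circle_mean :: "('a::complex_hilbert_space \<Rightarrow> ereal) \<Rightarrow> 'a \<Rightarrow> 'a \<Rightarrow> ereal" where
  "circle_mean u z h =
     ereal (1 / (2 * pi)) *
     ereal_integral (restrict_space lborel {0..2*pi}) (\<lambda>\<theta>. u (z + cis \<theta> *\<^sub>C h))"

definition usc_on :: "'a::topological_space set \<Rightarrow> ('a \<Rightarrow> ereal) \<Rightarrow> bool" where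
  "usc_on \<Omega> u \<longleftrightarrow> (\<forall>z\<in>\<Omega>. \<forall>c. u z < c \<longrightarrow> (\<forall>\<^sub>F w in at z within \<Omega>. u w < c))"

text \<open>The set \<open>\<Omega>\<close> is meant to be open; values of \<open>u\<close> outside \<open>\<Omega>\<close> are irrelevant.\<close>

definition psh_on :: "'a::complex_hilbert_space set \<Rightarrow> ('a \<Rightarrow> ereal) \<Rightarrow> bool" where
  "psh_on \<Omega> u \<longleftrightarrow>
     (\<forall>z\<in>\<Omega>. u z < \<infinity>) \<and>
     usc_on \<Omega> u \<and>
     (\<forall>C\<in>components \<Omega>. \<exists>z\<in>C. u z \<noteq> -\<infinity>) \<and>
     (\<forall>z\<in>\<Omega>. \<forall>h. (\<forall>\<zeta>. cmod \<zeta> \<le> 1 \<longrightarrow> z + \<zeta> *\<^sub>C h \<in> \<Omega>) \<longrightarrow> u z \<le> circle_mean u z h)"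

text \<open>
  First and second real Frechet derivative on an open set, as maps into spaces of bounded
  linear maps with the operator norm.
\<close>

definition D1 :: "('a::real_normed_vector \<Rightarrow> real) \<Rightarrow> 'a \<Rightarrow> ('a \<Rightarrow>\<^sub>L real)" where
  "D1 u a = Blinfun (frechet_derivative u (at a))"

definition D2 :: "('a::real_normed_vector \<Rightarrow> real) \<Rightarrow> 'a \<Rightarrow> ('a \<Rightarrow>\<^sub>L 'a \<Rightarrow>\<^sub>L real)" where
  "D2 u a = Blinfun (frechet_derivative (D1 u) (at a))"

definition C2_on :: "'a::real_normed_vector set \<Rightarrow> ('a \<Rightarrow> real) \<Rightarrow> bool" where
  "C2_on \<Omega> u \<longleftrightarrow>
     (\<forall>a\<in>\<Omega>. u differentiable (at a)) \<and>
     (\<forall>a\<in>\<Omega>. D1 u differentiable (at a)) \<and>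
     continuous_on \<Omega> (D2 u)"

definition levi_form :: "('a::complex_hilbert_space \<Rightarrow> real) \<Rightarrow> 'a \<Rightarrow> 'a \<Rightarrow> 'a \<Rightarrow> complex" where
  "levi_form u a s t =
     (let B = (\<lambda>x y. complex_of_real (blinfun_apply (blinfun_apply (D2 u a) x) y))
      in (B s t + B (\<i> *\<^sub>C s) (\<i> *\<^sub>C t) + \<i> * B s (\<i> *\<^sub>C t) - \<i> * B (\<i> *\<^sub>C s) t) / 4)"

text \<open>
  The bounded operator representing the Levi form. The type only records real linearity; complex
  linearity follows from that of the form in its first argument.
\<close>

definition levi_op :: "('a::complex_hilbert_space \<Rightarrow> real) \<Rightarrow> 'a \<Rightarrow> ('a \<Rightarrow>\<^sub>L 'a)" where
  "levi_op u a = (THE L. \<forall>s t. cinner (blinfun_apply L s) t = levi_form u a s t)"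

definition bounded_open_inside :: "'a::metric_space set \<Rightarrow> 'a set \<Rightarrow> bool" (infix "\<Subset>" 50) where
  "G \<Subset> \<Omega> \<longleftrightarrow> open G \<and> bounded G \<and> closure G \<subseteq> \<Omega>"

definition maximal_psh_on :: "'a::complex_hilbert_space set \<Rightarrow> ('a \<Rightarrow> ereal) \<Rightarrow> bool" where
  "maximal_psh_on \<Omega> u \<longleftrightarrow>
     psh_on \<Omega> u \<and>
     (\<forall>G v. G \<Subset> \<Omega> \<and> psh_on G v \<and>
        (\<forall>\<xi>\<in>frontier G. Limsup (at \<xi> within G) v \<le> u \<xi>) \<longrightarrow> (\<forall>z\<in>G. v z \<le> u z))"

end

theory Submission
  imports Defs
begin

text \<open>
  The point is that collective compactness makes the Levi form uniformly small in some complex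
  direction. Let \<open>G \<Subset> \<Omega>\<close> and \<open>\<epsilon> > 0\<close>. The relatively compact set of all vectors \<open>D'D''u(z)h\<close> has a
  finite \<open>\<epsilon>\<close>-net, and in infinite dimensions some unit vector \<open>h\<close> is orthogonal to this net. Then
  \<open>\<langle>D'D''u(z)h, h\<rangle> \<le> \<epsilon>\<close> at every \<open>z \<in> G\<close> at once (\<open>compact_operators_small_direction\<close>), so on each
  complex line parallel to \<open>h\<close> the function \<open>u - 2\<epsilon>\<parallel>z - z0\<parallel>\<^sup>2\<close> is strictly superharmonic.

  Although \<open>closure G\<close> is not compact, its intersection with a complex line is, and so the usual
  maximum principle applies on that slice. Suppose that a competitor \<open>v\<close> exceeds \<open>u\<close> at \<open>z0 \<in> G\<close>,
  and consider \<open>v - u + 2\<epsilon>\<parallel>z - z0\<parallel>\<^sup>2\<close> on the slice through \<open>z0\<close> in direction \<open>h\<close>. Its boundary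
  values are at most \<open>2\<epsilon>R\<^sup>2\<close>, where \<open>R\<close> bounds \<open>\<parallel>z - z0\<parallel>\<close> on \<open>G\<close> independently of \<open>\<epsilon>\<close>; for small
  \<open>\<epsilon>\<close> this is less than the value at \<open>z0\<close>. Hence the maximum is attained inside \<open>G\<close>, where \<open>v\<close>
  is touched from above by a strictly superharmonic function, and comparing means over a small
  circle gives a contradiction (\<open>psh_on_not_touched_from_above\<close>).

  The Levi operator is defined by a unique description, so its existence has to be established
  first; this is the Riesz representation theorem applied to the Levi form
  (\<open>cinner_levi_op\<close>).
\<close>

section \<open>Riesz representation and the Levi operator\<close>

text \<open>
  The form in which completeness enters the Riesz theorem: the parallelogram law bounds the distance
  of two almost minimisers by the sum of their defects \<open>r\<close>.
\<close>

lemma Cauchy_if_minimising_norm_square: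
  fixes X :: "nat \<Rightarrow> 'a::real_normed_vector"
  assumes bd: "\<And>m n. (norm (X m - X n))\<^sup>2 \<le> r m + r n"
    and r: "r \<longlonglongrightarrow> 0"
  shows "Cauchy X"
proof (rule metric_CauchyI)
  fix e :: real assume "e > 0"
  then have "e\<^sup>2 / 2 > 0" by simp
  then have "\<forall>\<^sub>F n in sequentially. r n < e\<^sup>2 / 2"
    by (rule order_tendstoD(2)[OF r])
  then obtain M where M: "\<And>n. n \<ge> M \<Longrightarrow> r n < e\<^sup>2 / 2"
    unfolding eventually_sequentially by blast
  have "dist (X m) (X n) < e" if "m \<ge> M" "n \<ge> M" for m n
  proof -
    have "(norm (X m - X n))\<^sup>2 < e\<^sup>2"
      using bd[of m n] M[OF that(1)] M[OF that(2)] by simp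
    then show ?thesis
      using \<open>e > 0\<close> by (simp add: dist_norm power2_less_imp_less)
  qed
  then show "\<exists>M. \<forall>m\<ge>M. \<forall>n\<ge>M. dist (X m) (X n) < e" by blast
qed

text \<open>
  The representing vector is the minimiser of the quadratic functional \<open>x \<mapsto> x \<bullet> x - 2 f x\<close>. The
  parallelogram law makes a minimising sequence Cauchy, and stationarity of the functional at the
  limit is the representation.
\<close>

theorem riesz_representation:
  fixes f :: "'a::{real_inner,complete_space} \<Rightarrow> real"
  assumes "bounded_linear f"
  shows "\<exists>x. \<forall>y. x \<bullet> y = f y"
proof -
  interpret f: bounded_linear f by fact
  define J where "J x = x \<bullet> x - 2 * f x" for x
  obtain k where k: "\<And>x. norm (f x) \<le> norm x * k" using f.bounded by blast
  have J_ge: "- (k\<^sup>2) \<le> J x" for x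
  proof -
    have "0 \<le> (norm x - k)\<^sup>2" by simp
    then have "2 * (norm x * k) \<le> (norm x)\<^sup>2 + k\<^sup>2"
      by (simp add: power2_eq_square algebra_simps)
    moreover have "f x \<le> norm x * k" using k[of x] by simp
    ultimately show ?thesis unfolding J_def power2_norm_eq_inner by linarith
  qed
  define m where "m = Inf (range J)"
  have bdd: "bdd_below (range J)" using J_ge by (auto intro!: bdd_belowI)
  have m_le: "m \<le> J x" for x unfolding m_def by (rule cInf_lower[OF _ bdd]) simp
  have "\<exists>x. J x < m + 1 / real (Suc n)" for n
    using cInf_lessD[of "range J" "m + 1 / real (Suc n)"] by (auto simp: m_def)
  then obtain X where X: "\<And>n. J (X n) < m + 1 / real (Suc n)" by metis
  have "Cauchy X"
  proof (rule Cauchy_if_minimising_norm_square)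
    fix i j
    have "(norm (X i - X j))\<^sup>2 = 2 * J (X i) + 2 * J (X j) - 4 * J ((1/2) *\<^sub>R (X i + X j))"
      unfolding J_def power2_norm_eq_inner f.scaleR f.add
      by (simp add: inner_simps inner_commute algebra_simps)
    also have "\<dots> \<le> 2 * (1 / real (Suc i)) + 2 * (1 / real (Suc j))"
      using X[of i] X[of j] m_le[of "(1/2) *\<^sub>R (X i + X j)"] by linarith
    finally show "(norm (X i - X j))\<^sup>2 \<le> 2 * (1 / real (Suc i)) + 2 * (1 / real (Suc j))" .
  next
    show "(\<lambda>n. 2 * (1 / real (Suc n))) \<longlonglongrightarrow> 0"
      using tendsto_mult[OF tendsto_const LIMSEQ_inverse_real_of_nat, of 2]
      by (simp add: divide_inverse)
  qed
  then obtain x where x: "X \<longlonglongrightarrow> x" using Cauchy_convergent convergent_def by blast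
  have "(\<lambda>n. J (X n)) \<longlonglongrightarrow> J x"
    unfolding J_def by (intro tendsto_intros x f.tendsto)
  moreover have "(\<lambda>n. m + 1 / real (Suc n)) \<longlonglongrightarrow> m + 0"
    using tendsto_add[OF tendsto_const LIMSEQ_inverse_real_of_nat, of m]
    by (simp add: divide_inverse)
  ultimately have "J x \<le> m + 0"
    by (rule LIMSEQ_le) (use X less_imp_le in blast)
  then have "J x \<le> m" by simp
  then have x_min: "J x \<le> J y" for y using m_le[of y] by linarith
  have "x \<bullet> y = f y" for y
  proof -
    define d where "d = x \<bullet> y - f y"
    have q: "0 \<le> 2 * t * d + t\<^sup>2 * (y \<bullet> y)" for t
    proof -
      have "J (x + t *\<^sub>R y) = J x + 2 * t * d + t\<^sup>2 * (y \<bullet> y)"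
        unfolding J_def f.add f.scaleR d_def
        by (simp add: inner_simps inner_commute algebra_simps power2_eq_square)
      then show ?thesis using x_min[of "x + t *\<^sub>R y"] by linarith
    qed
    \<comment> \<open>The quadratic in \<open>t\<close> is evaluated near its minimum \<open>- d / (y \<bullet> y)\<close>; adding 1 to the
      denominator avoids the case \<open>y = 0\<close>.\<close>
    define s where "s = y \<bullet> y + 1"
    have s: "s > 0" unfolding s_def using inner_ge_zero[of y] by linarith
    have "0 \<le> 2 * (- d / s) * d + (- d / s)\<^sup>2 * (y \<bullet> y)" by (rule q)
    also have "\<dots> = - (d\<^sup>2) * (s + 1) / s\<^sup>2"
      using s unfolding s_def by (simp add: power2_eq_square divide_simps) (simp add: algebra_simps)
    finally have "d\<^sup>2 * (s + 1) / s\<^sup>2 \<le> 0" by simp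
    then have "d = 0" using s by (simp add: divide_le_0_iff mult_le_0_iff)
    then show ?thesis by (simp add: d_def)
  qed
  then show ?thesis by blast
qed

lemma blinfun_real_le: "blinfun_apply f x \<le> norm f * norm x" for f :: "'a::real_normed_vector \<Rightarrow>\<^sub>L real"
  using norm_blinfun[of f x] by simp

lemma bounded_linear_riesz_operator:
  fixes L :: "'a::real_inner \<Rightarrow> 'a" and B :: "'a \<Rightarrow>\<^sub>L 'a \<Rightarrow>\<^sub>L real"
  assumes L: "\<And>s t. L s \<bullet> t = B s t"
  shows "bounded_linear L"
proof (rule bounded_linear_intro[where K = "norm B"])
  show "L (s + s') = L s + L s'" for s s'
    by (rule vector_eq_rdot[THEN iffD1])
      (simp add: L inner_simps blinfun.bilinear_simps)
  show "L (r *\<^sub>R s) = r *\<^sub>R L s" for r s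
    by (rule vector_eq_rdot[THEN iffD1])
      (simp add: L inner_simps blinfun.bilinear_simps)
  show "norm (L s) \<le> norm s * norm B" for s
  proof (cases "L s = 0")
    case False
    have "norm (L s) * norm (L s) = B s (L s)"
      by (metis L power2_eq_square power2_norm_eq_inner)
    also have "\<dots> \<le> norm (B s) * norm (L s)"
      by (rule blinfun_real_le)
    finally have "norm (L s) \<le> norm (B s)" using False by simp
    also have "\<dots> \<le> norm s * norm B" using norm_blinfun[of B s] by (simp add: mult.commute)
    finally show ?thesis .
  qed simp
qed

lemma norm_scaleC: "norm (c *\<^sub>C x) = cmod c * norm (x :: 'a::complex_hilbert_space)"
proof -
  have "cinner (c *\<^sub>C x) (c *\<^sub>C x) = c * cnj (cinner (c *\<^sub>C x) x)"
    by (metis cinner_scaleC_left cinner_commute)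
  also have "\<dots> = c * cnj c * cinner x x"
    by (metis cinner_scaleC_left cinner_commute complex_cnj_mult mult.assoc)
  also have "\<dots> = complex_of_real ((cmod c)\<^sup>2) * cinner x x"
    by (simp only: complex_norm_square)
  finally have "Re (cinner (c *\<^sub>C x) (c *\<^sub>C x)) = (cmod c)\<^sup>2 * Re (cinner x x)"
    by simp
  then have "(norm (c *\<^sub>C x))\<^sup>2 = (cmod c * norm x)\<^sup>2"
    by (simp add: Re_cinner power2_norm_eq_inner[symmetric] power_mult_distrib)
  then show ?thesis by simp
qed

lemma scaleC_cis: "cis \<theta> *\<^sub>C x = cos \<theta> *\<^sub>R x + sin \<theta> *\<^sub>R (\<i> *\<^sub>C x)"
proof -
  have "cis \<theta> = complex_of_real (cos \<theta>) + complex_of_real (sin \<theta>) * \<i>"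
    by (simp add: complex_eq_iff)
  then show ?thesis
    by (simp only: scaleC_add_left scaleC_of_real scaleC_scaleC[symmetric])
qed

lemma scaleC_scaleR_commute:
  "c *\<^sub>C (r *\<^sub>R x) = r *\<^sub>R (c *\<^sub>C (x :: 'a::complex_hilbert_space))"
  by (simp only: scaleC_of_real[symmetric] scaleC_scaleC mult.commute)

lemma bounded_linear_scaleC: "bounded_linear (\<lambda>x :: 'a::complex_hilbert_space. c *\<^sub>C x)"
  by (rule bounded_linear_intro[where K = "cmod c"])
    (simp_all add: scaleC_add_right scaleC_scaleR_commute norm_scaleC)

lemma bounded_linear_scaleC_left: "bounded_linear (\<lambda>c. c *\<^sub>C (x :: 'a::complex_hilbert_space))"
proof (rule bounded_linear_intro[where K = "norm x"])
  show "(r *\<^sub>R c) *\<^sub>C x = r *\<^sub>R (c *\<^sub>C x)" for r c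
    by (simp only: scaleR_conv_of_real scaleC_scaleC[symmetric] scaleC_of_real)
qed (simp_all add: scaleC_add_left norm_scaleC)

text \<open>
  The complex inner product is determined by its real part, so the real Riesz theorem suffices to
  represent a form which is conjugate linear in its second argument.
\<close>

lemma Im_cinner:
  "Im (cinner x y) = x \<bullet> (\<i> *\<^sub>C (y :: 'a::complex_hilbert_space))"
proof -
  have "cinner x (\<i> *\<^sub>C y) = cnj (\<i> * cinner y x)"
    by (metis cinner_scaleC_left cinner_commute)
  also have "\<dots> = - \<i> * cinner x y"
    by (simp add: cinner_commute[of x y])
  finally show ?thesis by (simp flip: Re_cinner)
qed

lemma scaleC_i_i: "\<i> *\<^sub>C \<i> *\<^sub>C x = - (x :: 'a::complex_hilbert_space)"
  using scaleC_scaleC[of \<i> \<i> x] scaleC_of_real[of "-1" x] by simp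

text \<open>
  The real part of the Levi form is the bounded real bilinear form \<open>B\<close> below, which Riesz
  represents by an operator \<open>L\<close>. Since the Levi form is conjugate linear in its second argument,
  its imaginary part is the real part with \<open>t\<close> replaced by \<open>\<i> t\<close>, so \<open>L\<close> represents
  it as well.
\<close>

lemma cinner_levi_op: "cinner (levi_op u a s) t = levi_form u a s t"
proof -
  let ?J = "Blinfun (\<lambda>x :: 'a. \<i> *\<^sub>C x)"
  have J: "?J x = \<i> *\<^sub>C x" for x
    by (simp add: bounded_linear_Blinfun_apply bounded_linear_scaleC)
  define f where "f s t = (D2 u a s t + D2 u a (\<i> *\<^sub>C s) (\<i> *\<^sub>C t)) / 4" for s t
  define B where "B = (1/4) *\<^sub>R
    (D2 u a + blinfun_compose (Blinfun (\<lambda>g. blinfun_compose g ?J)) (blinfun_compose (D2 u a) ?J))"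
  have comp: "Blinfun (\<lambda>g :: 'a \<Rightarrow>\<^sub>L real. blinfun_compose g ?J) g = blinfun_compose g ?J" for g
    by (simp add: bounded_linear_Blinfun_apply bounded_linear_intros)
  have B: "B s t = f s t" for s t
    by (simp add: B_def f_def blinfun.bilinear_simps comp J)
  have "\<exists>x. \<forall>t. x \<bullet> t = B s t" for s
    by (rule riesz_representation) (simp add: blinfun.bounded_linear_right)
  then obtain L where L: "\<And>s t. L s \<bullet> t = B s t" by metis
  have "bounded_linear L" by (rule bounded_linear_riesz_operator[OF L])
  then have L': "blinfun_apply (Blinfun L) = L" by (rule bounded_linear_Blinfun_apply)
  have L_levi: "cinner (Blinfun L s) t = levi_form u a s t" for s t
    by (rule complex_eqI)
      (simp_all add: L' Re_cinner Im_cinner L B f_def levi_form_def Let_def scaleC_i_i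
        blinfun.bilinear_simps)
  have "\<forall>s t. cinner (levi_op u a s) t = levi_form u a s t"
    unfolding levi_op_def
  proof (rule theI[where a = "Blinfun L"])
    show "\<forall>s t. cinner (Blinfun L s) t = levi_form u a s t" using L_levi by blast
  next
    fix M assume M: "\<forall>s t. cinner (blinfun_apply M s) t = levi_form u a s t"
    show "M = Blinfun L"
    proof (rule blinfun_eqI)
      fix s
      have "M s \<bullet> t = Blinfun L s \<bullet> t" for t
        using M L_levi by (simp flip: Re_cinner)
      then show "M s = Blinfun L s" using vector_eq_rdot by blast
    qed
  qed
  then show ?thesis by blast
qed

text \<open>
  The left hand side is the Laplacian of \<open>u\<close> along the complex line in direction \<open>h\<close>.
\<close>

lemma D2_complex_line_trace:
  "D2 u a h h + D2 u a (\<i> *\<^sub>C h) (\<i> *\<^sub>C h) = 4 * (levi_op u a h \<bullet> h)"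
  using arg_cong[where f = Re, OF cinner_levi_op[of u a h h]]
  by (simp add: Re_cinner levi_form_def Let_def)

section \<open>Orthogonality to a finite set\<close>

text \<open>
  One Gram-Schmidt step per element of \<open>K\<close>. Working with finite sets avoids any basis or dimension
  count; if \<open>x\<close> already lies in the span of \<open>K\<close>, then \<open>q1 = 0\<close> and the convention \<open>0 / 0 = 0\<close>
  makes the same formula correct.
\<close>

lemma decompose_wrt_finite_set:
  fixes y :: "'a::real_inner"
  assumes "finite K"
  shows "\<exists>p q. y = p + q \<and> p \<in> span K \<and> (\<forall>x\<in>K. x \<bullet> q = 0)"
  using assms
proof (induction K arbitrary: y)
  case empty
  then show ?case by auto
next
  case (insert x K)
  obtain p1 q1 where 1: "x = p1 + q1" "p1 \<in> span K" "\<forall>z\<in>K. z \<bullet> q1 = 0"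
    using insert.IH by blast
  obtain p2 q2 where 2: "y = p2 + q2" "p2 \<in> span K" "\<forall>z\<in>K. z \<bullet> q2 = 0"
    using insert.IH by blast
  define c where "c = (q1 \<bullet> q2) / (q1 \<bullet> q1)"
  define q where "q = q2 - c *\<^sub>R q1"
  have K: "z \<bullet> q = 0" if "z \<in> K" for z
    using 1 2 that by (simp add: q_def inner_simps)
  have "p1 \<bullet> q = 0"
    by (rule real_vector.span_induct[OF 1(2)])
      (auto simp: K inner_simps intro!: real_vector.subspaceI)
  moreover have "q1 \<bullet> q = 0"
    by (simp add: q_def c_def inner_simps)
  ultimately have "x \<bullet> q = 0" by (simp add: 1(1) inner_simps)
  moreover have "y = (p2 + c *\<^sub>R (x - p1)) + q"
    using 1(1) 2(1) by (simp add: q_def)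
  moreover have "p2 + c *\<^sub>R (x - p1) \<in> span (insert x K)"
    using 1(2) 2(2) real_vector.span_mono[of K "insert x K"]
    by (auto intro!: real_vector.span_add real_vector.span_scale real_vector.span_diff
        intro: real_vector.span_base)
  ultimately show ?case using K by blast
qed

lemma span_subset_complex_span: "span K \<subseteq> complex_vector.span (K :: 'a::complex_hilbert_space set)"
proof (rule real_vector.span_minimal)
  show "K \<subseteq> complex_vector.span K" by (rule complex_vector.span_superset)
  show "subspace (complex_vector.span K)"
    by (auto intro!: real_vector.subspaceI complex_vector.span_add complex_vector.span_zero
        complex_vector.span_scale simp flip: scaleC_of_real)
qed

lemma unit_vector_orthogonal_to_finite_set:
  fixes K :: "'a::complex_hilbert_space set"
  assumes inf: "\<nexists>B :: 'a set. finite B \<and> complex_vector.span B = UNIV"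
    and "finite K"
  shows "\<exists>h. norm h = 1 \<and> (\<forall>x\<in>K. x \<bullet> h = 0)"
proof -
  obtain y where y: "y \<notin> complex_vector.span K" using assms by blast
  obtain p q where pq: "y = p + q" "p \<in> span K" "\<forall>x\<in>K. x \<bullet> q = 0"
    using decompose_wrt_finite_set[OF \<open>finite K\<close>] by blast
  have "q \<noteq> 0" using y pq span_subset_complex_span[of K] by auto
  then show ?thesis using pq(3)
    by (intro exI[of _ "(1 / norm q) *\<^sub>R q"]) simp
qed

text \<open>
  A direction orthogonal to a finite \<open>\<epsilon>\<close>-net of the common image of the unit ball is almost
  annihilated, in the sense of the quadratic form, by all operators of the family simultaneously.
\<close>

lemma compact_operators_small_direction:
  fixes L :: "'b \<Rightarrow> 'a::complex_hilbert_space \<Rightarrow>\<^sub>L 'a"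
  assumes inf: "\<nexists>B :: 'a set. finite B \<and> complex_vector.span B = UNIV"
    and cpt: "compact (closure {L z h | z h. z \<in> G \<and> norm h \<le> 1})"
    and "\<epsilon> > 0"
  shows "\<exists>h. norm h = 1 \<and> (\<forall>z\<in>G. L z h \<bullet> h \<le> \<epsilon>)"
proof -
  let ?S = "{L z h | z h. z \<in> G \<and> norm h \<le> 1}"
  obtain K where K: "finite K" "closure ?S \<subseteq> (\<Union>x\<in>K. ball x \<epsilon>)"
    using cpt \<open>\<epsilon> > 0\<close> unfolding compact_eq_totally_bounded by blast
  obtain h where h: "norm h = 1" "\<forall>x\<in>K. x \<bullet> h = 0"
    using unit_vector_orthogonal_to_finite_set[OF inf K(1)] by blast
  have "L z h \<bullet> h \<le> \<epsilon>" if "z \<in> G" for z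
  proof -
    have "L z h \<in> ?S" using that h(1) by (intro CollectI exI[of _ z] exI[of _ h]) simp
    then have "L z h \<in> closure ?S" by (rule subsetD[OF closure_subset])
    then obtain x where x: "x \<in> K" "dist x (L z h) < \<epsilon>" using K(2) by auto
    have "L z h \<bullet> h = (L z h - x) \<bullet> h" using h(2) x(1) by (simp add: inner_simps)
    also have "\<dots> \<le> norm (L z h - x) * norm h" by (rule norm_cauchy_schwarz)
    also have "\<dots> \<le> \<epsilon>" using x(2) h(1) by (simp add: dist_norm norm_minus_commute)
    finally show ?thesis .
  qed
  then show ?thesis using h(1) by blast
qed

section \<open>Circle means and second order expansion\<close>

lemma ereal_integral_mono:
  assumes "\<And>x. x \<in> space M \<Longrightarrow> f x \<le> g x"
  shows "ereal_integral M f \<le> ereal_integral M g"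
proof -
  have "(\<integral>\<^sup>+x. e2ennreal (f x) \<partial>M) \<le> (\<integral>\<^sup>+x. e2ennreal (g x) \<partial>M)"
    by (intro nn_integral_mono e2ennreal_mono assms)
  moreover have "(\<integral>\<^sup>+x. e2ennreal (- g x) \<partial>M) \<le> (\<integral>\<^sup>+x. e2ennreal (- f x) \<partial>M)"
    by (intro nn_integral_mono e2ennreal_mono) (simp add: assms)
  ultimately show ?thesis
    unfolding ereal_integral_def by (intro ereal_minus_mono) (simp_all add: less_eq_ennreal.rep_eq)
qed

lemma ereal_integral_ereal:
  assumes "integrable M f"
  shows "ereal_integral M (\<lambda>x. ereal (f x)) = ereal (integral\<^sup>L M f)"
proof -
  have e: "e2ennreal (ereal r) = ennreal r" for r by (simp add: ennreal.rep_eq e2ennreal_def ennreal_def)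
  have f: "enn2ereal x = ereal (enn2real x)" if "x \<noteq> top" for x
    using that by (cases x) auto
  show ?thesis
    using assms unfolding ereal_integral_def
    by (simp add: e real_lebesgue_integral_def real_integrable_def f)
qed

text \<open>
  The second order expansion of a function on a small circle is a trigonometric polynomial of this form;
  only its constant term survives integration.
\<close>

lemma circle_mean_le_trigonometric:
  fixes A B C D K :: real
  assumes "\<And>\<theta>. v (z + cis \<theta> *\<^sub>C h) \<le>
      ereal (K + A * cos \<theta> + B * sin \<theta> + C * cos (2 * \<theta>) + D * sin (2 * \<theta>))"
  shows "circle_mean v z h \<le> ereal K"
proof -
  define T where "T \<theta> = K + A * cos \<theta> + B * sin \<theta> + C * cos (2 * \<theta>) + D * sin (2 * \<theta>)" for \<theta>
  define P where
    "P \<theta> = K * \<theta> + A * sin \<theta> - B * cos \<theta> + C * (sin (2 * \<theta>) / 2) - D * (cos (2 * \<theta>) / 2)" for \<theta>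
  let ?I = "{0..2*pi}"
  let ?M = "restrict_space lborel ?I"
  have cont: "continuous_on ?I T" unfolding T_def by (intro continuous_intros)
  have "integrable ?M T"
    using borel_integrable_atLeastAtMost'[OF cont]
    by (simp add: integrable_restrict_space set_integrable_def)
  then have "ereal_integral ?M (\<lambda>\<theta>. ereal (T \<theta>)) = ereal (integral\<^sup>L ?M T)"
    by (rule ereal_integral_ereal)
  also have "integral\<^sup>L ?M T = (\<integral>\<theta>. indicator ?I \<theta> *\<^sub>R T \<theta> \<partial>lborel)"
    by (rule integral_restrict_space) simp
  also have "\<dots> = P (2 * pi) - P 0"
  proof (rule integral_FTC_atLeastAtMost)
    fix x
    have "(P has_field_derivative T x) (at x within ?I)"
      unfolding P_def T_def by (auto intro!: derivative_eq_intros)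
    then show "(P has_vector_derivative T x) (at x within ?I)"
      by (simp add: has_real_derivative_iff_has_vector_derivative)
  qed (use cont in auto)
  also have "\<dots> = 2 * pi * K"
  proof -
    have "sin (4 * pi) = 0" "cos (4 * pi) = 1"
      using sin_npi[of 4] cos_npi[of 4] by simp_all
    then show ?thesis by (simp add: P_def)
  qed
  finally have T: "ereal_integral ?M (\<lambda>\<theta>. ereal (T \<theta>)) = ereal (2 * pi * K)" .
  have "ereal_integral ?M (\<lambda>\<theta>. v (z + cis \<theta> *\<^sub>C h)) \<le> ereal (2 * pi * K)"
    using ereal_integral_mono[of ?M "\<lambda>\<theta>. v (z + cis \<theta> *\<^sub>C h)" "\<lambda>\<theta>. ereal (T \<theta>)"] assms
    by (simp add: T flip: T_def)
  then have "circle_mean v z h \<le> ereal (1 / (2 * pi)) * ereal (2 * pi * K)"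
    unfolding circle_mean_def by (intro ereal_mult_left_mono) auto
  then show ?thesis by simp
qed

lemma C2_on_has_derivative:
  assumes "C2_on \<Omega> u" "a \<in> \<Omega>"
  shows "(u has_derivative blinfun_apply (D1 u a)) (at a)"
    and "(D1 u has_derivative blinfun_apply (D2 u a)) (at a)"
proof -
  have "(u has_derivative frechet_derivative u (at a)) (at a)"
    using assms by (simp add: C2_on_def frechet_derivative_works)
  then show "(u has_derivative blinfun_apply (D1 u a)) (at a)"
    by (simp add: D1_def bounded_linear_Blinfun_apply[OF has_derivative_bounded_linear])
  have "(D1 u has_derivative frechet_derivative (D1 u) (at a)) (at a)"
    using assms by (simp add: C2_on_def frechet_derivative_works)
  then show "(D1 u has_derivative blinfun_apply (D2 u a)) (at a)"
    by (simp add: D2_def bounded_linear_Blinfun_apply[OF has_derivative_bounded_linear])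
qed

text \<open>
  The mean value theorem on the segment from \<open>a\<close> to \<open>a + e\<close> reduces this to the differentiability of
  \<open>D1 u\<close> at \<open>a\<close>; the bound is uniform over all directions, hence over a circle.
\<close>

lemma C2_on_taylor_upper:
  fixes u :: "'a::real_normed_vector \<Rightarrow> real"
  assumes "open \<Omega>" "C2_on \<Omega> u" "a \<in> \<Omega>" "\<eta> > 0"
  obtains \<delta> where "\<delta> > 0"
    "\<And>e. norm e < \<delta> \<Longrightarrow> u (a + e) \<le> u a + D1 u a e + D2 u a e e / 2 + \<eta> * (norm e)\<^sup>2"
proof -
  obtain r where r: "r > 0" "ball a r \<subseteq> \<Omega>" using assms openE by blast
  obtain d where d: "d > 0"
    "\<And>y. norm (y - a) < d \<Longrightarrow> norm (D1 u y - D1 u a - D2 u a (y - a)) \<le> \<eta> * norm (y - a)"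
    using C2_on_has_derivative(2)[OF assms(2,3)] \<open>\<eta> > 0\<close>
    unfolding has_derivative_at_alt by blast
  show thesis
  proof (rule that[of "min r d"])
    show "min r d > 0" using r d by simp
    fix e :: 'a assume e: "norm e < min r d"
    define g where "g t = u (a + t *\<^sub>R e) - t * D1 u a e - t\<^sup>2 / 2 * D2 u a e e" for t
    define g' where "g' t = D1 u (a + t *\<^sub>R e) e - D1 u a e - t * D2 u a e e" for t
    have small: "norm (t *\<^sub>R e) \<le> norm e" if "0 \<le> t" "t \<le> 1" for t
      using that by (simp add: mult_left_le_one_le)
    have deriv: "(g has_field_derivative g' t) (at t)" if t: "0 \<le> t" "t \<le> 1" for t
    proof -
      have "a + t *\<^sub>R e \<in> ball a r" using small[OF t] e by (simp add: dist_norm)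
      then have "a + t *\<^sub>R e \<in> \<Omega>" using r(2) by blast
      then have "(u has_derivative blinfun_apply (D1 u (a + t *\<^sub>R e))) (at (a + t *\<^sub>R e))"
        using C2_on_has_derivative(1)[OF assms(2)] by blast
      then have "((\<lambda>t. u (a + t *\<^sub>R e)) has_derivative (\<lambda>h. D1 u (a + t *\<^sub>R e) (h *\<^sub>R e))) (at t)"
        by (rule has_derivative_compose[of "\<lambda>t. a + t *\<^sub>R e" "\<lambda>h. h *\<^sub>R e", rotated])
          (auto intro!: derivative_eq_intros)
      then have "((\<lambda>t. u (a + t *\<^sub>R e)) has_field_derivative D1 u (a + t *\<^sub>R e) e) (at t)"
        by (rule has_derivative_imp_has_field_derivative) (simp add: blinfun.bilinear_simps mult.commute)
      then show ?thesis unfolding g_def g'_def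
        by (auto intro!: derivative_eq_intros)
    qed
    have "\<exists>t>0. t < 1 \<and> g 1 - g 0 = (1 - 0) * g' t"
      by (rule MVT2) (simp_all add: deriv)
    then obtain t where t: "0 < t" "t < 1" "g 1 - g 0 = g' t" by auto
    have "g' t = (D1 u (a + t *\<^sub>R e) - D1 u a - D2 u a (t *\<^sub>R e)) e"
      by (simp add: g'_def blinfun.bilinear_simps)
    also have "\<dots> \<le> norm (D1 u (a + t *\<^sub>R e) - D1 u a - D2 u a (t *\<^sub>R e)) * norm e"
      by (rule blinfun_real_le)
    also have "\<dots> \<le> \<eta> * norm (t *\<^sub>R e) * norm e"
    proof (rule mult_right_mono)
      have "norm (a + t *\<^sub>R e - a) < d" using small[of t] t(1,2) e by simp
      from d(2)[OF this] show "norm (D1 u (a + t *\<^sub>R e) - D1 u a - D2 u a (t *\<^sub>R e)) \<le> \<eta> * norm (t *\<^sub>R e)"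
        by simp
    qed simp
    also have "\<dots> \<le> \<eta> * norm e * norm e"
      using small[of t] t(1,2) \<open>\<eta> > 0\<close> by (intro mult_right_mono mult_left_mono) simp_all
    finally show "u (a + e) \<le> u a + D1 u a e + D2 u a e e / 2 + \<eta> * (norm e)\<^sup>2"
      using t(3) by (simp add: g_def power2_eq_square)
  qed
qed

section \<open>Semicontinuity and maxima\<close>

lemma usc_on_subset:
  assumes "usc_on S f" "T \<subseteq> S"
  shows "usc_on T f"
  unfolding usc_on_def
proof (intro ballI allI impI)
  fix z c assume "z \<in> T" "f z < c"
  then have "\<forall>\<^sub>F w in at z within S. f w < c"
    using assms by (auto simp: usc_on_def)
  then show "\<forall>\<^sub>F w in at z within T. f w < c"
    by (rule filter_leD[OF at_le[OF assms(2)]])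
qed

lemma usc_on_attains_max:
  fixes f :: "'a::topological_space \<Rightarrow> ereal"
  assumes "compact K" "K \<noteq> {}" "usc_on K f"
  shows "\<exists>a\<in>K. \<forall>z\<in>K. f z \<le> f a"
proof (rule ccontr)
  assume "\<not> ?thesis"
  then have "\<forall>a\<in>K. \<exists>b. b \<in> K \<and> f a < f b" by (meson not_le)
  then obtain b where b: "\<And>a. a \<in> K \<Longrightarrow> b a \<in> K" "\<And>a. a \<in> K \<Longrightarrow> f a < f (b a)"
    by metis
  have "\<forall>a\<in>K. \<exists>U. open U \<and> a \<in> U \<and> (\<forall>w\<in>U \<inter> K. f w < f (b a))"
  proof
    fix a assume "a \<in> K"
    then have "\<forall>\<^sub>F w in at a within K. f w < f (b a)"
      using assms(3) b(2) by (simp add: usc_on_def)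
    then obtain U where U: "open U" "a \<in> U" "\<forall>w\<in>U. w \<noteq> a \<longrightarrow> w \<in> K \<longrightarrow> f w < f (b a)"
      unfolding eventually_at_topological by blast
    then show "\<exists>U. open U \<and> a \<in> U \<and> (\<forall>w\<in>U \<inter> K. f w < f (b a))"
      using b(2)[OF \<open>a \<in> K\<close>] by (intro exI[of _ U]) auto
  qed
  then obtain U where U: "\<And>a. a \<in> K \<Longrightarrow> open (U a)" "\<And>a. a \<in> K \<Longrightarrow> a \<in> U a"
    "\<And>a w. a \<in> K \<Longrightarrow> w \<in> U a \<Longrightarrow> w \<in> K \<Longrightarrow> f w < f (b a)"
    by (metis IntI)
  obtain D where D: "D \<subseteq> K" "finite D" "K \<subseteq> (\<Union>a\<in>D. U a)"
    using compactE_image[OF \<open>compact K\<close>, of K U] U(1,2) by blast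
  let ?V = "(\<lambda>a. f (b a)) ` D"
  have V: "finite ?V" "?V \<noteq> {}" using D \<open>K \<noteq> {}\<close> by auto
  obtain d where d: "d \<in> D" "Max ?V = f (b d)" using Max_in[OF V] by auto
  have "b d \<in> K" using b(1) d(1) D(1) by blast
  then obtain a where a: "a \<in> D" "b d \<in> U a" using D(3) by blast
  have "f (b d) < f (b a)" using U(3) a D(1) \<open>b d \<in> K\<close> by blast
  moreover have "f (b a) \<le> f (b d)" using Max_ge[OF V(1), of "f (b a)"] a(1) d(2) by auto
  ultimately show False by simp
qed

text \<open>
  The comparison function \<open>v - u + q\<close> together with the upper bound \<open>q\<close> for its boundary values. Here
  \<open>v\<close> may take the value \<open>-\<infinity>\<close>, so the argument runs through a real number \<open>s\<close> which separates \<open>v\<close>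
  near \<open>z\<close> from \<open>t + u z - q z\<close>.
\<close>

lemma usc_on_closure_extension:
  fixes u q :: "'a::topological_space \<Rightarrow> real" and v :: "'a \<Rightarrow> ereal"
  assumes "open G" and u: "continuous_on (closure G) u" and q: "continuous_on (closure G) q"
    and v: "usc_on G v"
    and lim: "\<And>\<xi>. \<xi> \<in> frontier G \<Longrightarrow> Limsup (at \<xi> within G) v \<le> ereal (u \<xi>)"
  shows "usc_on (closure G) (\<lambda>z. if z \<in> G then v z + ereal (q z - u z) else ereal (q z))"
    (is "usc_on _ ?W")
  unfolding usc_on_def
proof (intro ballI allI impI)
  fix z t assume z: "z \<in> closure G" and t: "?W z < t"
  let ?F = "at z within closure G"
  have u_lim: "(u \<longlongrightarrow> u z) ?F" and q_lim: "(q \<longlongrightarrow> q z) ?F"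
    using u q z by (auto simp: continuous_on_def)
  have to_closure: "\<forall>\<^sub>F w in ?F. w \<in> G \<longrightarrow> P w" if "\<forall>\<^sub>F w in at z within G. P w" for P
    using that unfolding eventually_at_topological by blast
  have "\<exists>s::real. (\<forall>\<^sub>F w in at z within G. v w < ereal s) \<and> ereal (s + (q z - u z)) < t"
  proof (cases "z \<in> G")
    case True
    then have "v z < t - ereal (q z - u z)"
      using t by (simp add: ereal_less_minus_iff)
    then obtain s where s: "v z < ereal s" "ereal s < t - ereal (q z - u z)"
      using ereal_dense2 by blast
    then have "ereal (s + (q z - u z)) < t" by (simp add: ereal_less_minus_iff)
    moreover have "\<forall>\<^sub>F w in at z within G. v w < ereal s"
      using v True s(1) by (simp add: usc_on_def)
    ultimately show ?thesis by blast
  next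
    case False
    then have "ereal (u z) < t - ereal (q z - u z)"
      using t by (simp add: ereal_less_minus_iff)
    then obtain s where s: "ereal (u z) < ereal s" "ereal s < t - ereal (q z - u z)"
      using ereal_dense2 by blast
    then have "ereal (s + (q z - u z)) < t" by (simp add: ereal_less_minus_iff)
    moreover have "z \<in> frontier G"
      using False z \<open>open G\<close> by (simp add: frontier_def interior_open)
    then have "Limsup (at z within G) v < ereal s"
      using lim s(1) order_le_less_trans by blast
    then have "\<forall>\<^sub>F w in at z within G. v w < ereal s" by (rule Limsup_lessD)
    ultimately show ?thesis by blast
  qed
  then obtain s where s: "\<forall>\<^sub>F w in at z within G. v w < ereal s" "ereal (s + (q z - u z)) < t"
    by blast
  have "((\<lambda>w. ereal (s + (q w - u w))) \<longlongrightarrow> ereal (s + (q z - u z))) ?F"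
    by (intro tendsto_intros u_lim q_lim)
  then have "\<forall>\<^sub>F w in ?F. ereal (s + (q w - u w)) < t"
    using s(2) by (rule order_tendstoD(2))
  with to_closure[OF s(1)] have inside: "\<forall>\<^sub>F w in ?F. w \<in> G \<longrightarrow> ?W w < t"
  proof eventually_elim
    case (elim w)
    have "?W w < t" if "w \<in> G"
    proof -
      have "v w + ereal (q w - u w) \<le> ereal s + ereal (q w - u w)"
        using elim(1) that by (intro add_right_mono) auto
      also have "\<dots> < t" using elim(2) by simp
      finally show ?thesis using that by simp
    qed
    then show ?case by blast
  qed
  have outside: "\<forall>\<^sub>F w in ?F. w \<notin> G \<longrightarrow> ?W w < t"
  proof (cases "z \<in> G")
    case True
    then have "\<forall>\<^sub>F w in ?F. w \<in> G"
      using \<open>open G\<close> by (metis eventually_at_topological)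
    then show ?thesis by (rule eventually_mono) simp
  next
    case False
    have "((\<lambda>w. ereal (q w)) \<longlongrightarrow> ereal (q z)) ?F"
      by (intro tendsto_intros q_lim)
    then have "\<forall>\<^sub>F w in ?F. ereal (q w) < t"
      using t False by (intro order_tendstoD(2)) auto
    then show ?thesis by (rule eventually_mono) simp
  qed
  show "\<forall>\<^sub>F w in ?F. ?W w < t"
    using inside outside by eventually_elim blast
qed

section \<open>Maximum principle on a complex line\<close>

text \<open>
  Along the complex line through \<open>a\<close> in direction \<open>h\<close>, the function \<open>\<phi> = m + u - c\<parallel>z - z0\<parallel>\<^sup>2\<close> has
  Laplacian \<open>4(\<langle>D'D''u(a)h, h\<rangle> - c) < 0\<close> at \<open>a\<close>, so its mean over a small circle around \<open>a\<close> is less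
  than \<open>\<phi> a\<close>. If \<open>v \<le> \<phi>\<close> with equality at \<open>a\<close>, this violates the mean value inequality for \<open>v\<close>.
\<close>

lemma psh_on_not_touched_from_above:
  fixes u :: "'a::complex_hilbert_space \<Rightarrow> real"
  assumes "open \<Omega>" "C2_on \<Omega> u" "open G" "G \<subseteq> \<Omega>" "psh_on G v" "a \<in> G" "norm h = 1"
    and c: "levi_op u a h \<bullet> h < c"
    and eq: "v a = ereal (m + u a - c * (norm (a - z0))\<^sup>2)"
    and le: "\<And>\<zeta>. a + \<zeta> *\<^sub>C h \<in> G \<Longrightarrow>
      v (a + \<zeta> *\<^sub>C h) \<le> ereal (m + u (a + \<zeta> *\<^sub>C h) - c * (norm (a + \<zeta> *\<^sub>C h - z0))\<^sup>2)"
  shows False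
proof -
  \<comment> \<open>Half of the gap is spent on the Taylor remainder; the other half keeps the constant term
    strictly below \<open>\<phi> a\<close>.\<close>
  define \<eta> where "\<eta> = (c - levi_op u a h \<bullet> h) / 2"
  have "\<eta> > 0" using c by (simp add: \<eta>_def)
  have "a \<in> \<Omega>" using assms by blast
  then obtain \<delta> where \<delta>: "\<delta> > 0"
    "\<And>e. norm e < \<delta> \<Longrightarrow> u (a + e) \<le> u a + D1 u a e + D2 u a e e / 2 + \<eta> * (norm e)\<^sup>2"
    using C2_on_taylor_upper[OF assms(1,2) _ \<open>\<eta> > 0\<close>] by blast
  obtain \<rho> where \<rho>: "\<rho> > 0" "ball a \<rho> \<subseteq> G" using \<open>open G\<close> \<open>a \<in> G\<close> openE by blast
  define r where "r = min \<rho> \<delta> / 2"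
  have r: "r > 0" "r < \<rho>" "r < \<delta>" using \<rho>(1) \<delta>(1) by (auto simp: r_def min_def)
  define j where "j = \<i> *\<^sub>C h"
  have disc: "a + \<zeta> *\<^sub>C (r *\<^sub>R h) \<in> G" if "cmod \<zeta> \<le> 1" for \<zeta>
  proof -
    have "norm (\<zeta> *\<^sub>C (r *\<^sub>R h)) \<le> r"
      using that r(1) \<open>norm h = 1\<close> by (simp add: norm_scaleC mult_left_le_one_le)
    then have "a + \<zeta> *\<^sub>C (r *\<^sub>R h) \<in> ball a \<rho>" using r(2) by (simp add: dist_norm)
    then show ?thesis using \<rho>(2) by blast
  qed
  \<comment> \<open>The coefficients of the upper bound for \<open>v\<close> on the circle of radius \<open>r\<close>, after rewriting the
    quadratic terms in the double angle.\<close>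
  define K where "K = m + u a - c * (norm (a - z0))\<^sup>2 - \<eta> * r\<^sup>2"
  define A where "A = r * D1 u a h - 2 * c * r * ((a - z0) \<bullet> h)"
  define B where "B = r * D1 u a j - 2 * c * r * ((a - z0) \<bullet> j)"
  define C where "C = r\<^sup>2 / 4 * (D2 u a h h - D2 u a j j)"
  define D where "D = r\<^sup>2 / 4 * (D2 u a h j + D2 u a j h)"
  have "v (a + cis \<theta> *\<^sub>C (r *\<^sub>R h)) \<le>
      ereal (K + A * cos \<theta> + B * sin \<theta> + C * cos (2 * \<theta>) + D * sin (2 * \<theta>))" for \<theta>
  proof -
    define e where "e = cis \<theta> *\<^sub>C (r *\<^sub>R h)"
    have e: "e = (r * cos \<theta>) *\<^sub>R h + (r * sin \<theta>) *\<^sub>R j"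
      by (simp add: e_def j_def scaleC_cis scaleC_scaleR_commute scaleR_add_right)
    have e': "e = (cis \<theta> * complex_of_real r) *\<^sub>C h"
      by (simp only: e_def scaleC_of_real scaleC_scaleC[symmetric])
    have ne: "norm e = r" using r(1) \<open>norm h = 1\<close> by (simp add: e_def norm_scaleC)
    have "a + e \<in> G" unfolding e_def by (rule disc) simp
    then have "v (a + e) \<le> ereal (m + u (a + e) - c * (norm (a + e - z0))\<^sup>2)"
      using le[of "cis \<theta> * complex_of_real r"] by (simp only: e')
    also have "m + u (a + e) - c * (norm (a + e - z0))\<^sup>2 \<le>
        m + (u a + D1 u a e + D2 u a e e / 2 + \<eta> * r\<^sup>2)
          - c * ((norm (a - z0))\<^sup>2 + 2 * ((a - z0) \<bullet> e) + r\<^sup>2)"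
    proof -
      have "(norm (a + e - z0))\<^sup>2 = (norm (a - z0))\<^sup>2 + 2 * ((a - z0) \<bullet> e) + (norm e)\<^sup>2"
        unfolding power2_norm_eq_inner by (simp add: inner_simps inner_commute)
      then show ?thesis using \<delta>(2)[of e] r(3) ne by simp
    qed
    also have "\<dots> = K + A * cos \<theta> + B * sin \<theta> + C * cos (2 * \<theta>) + D * sin (2 * \<theta>)"
    proof -
      have d1: "D1 u a e = r * cos \<theta> * D1 u a h + r * sin \<theta> * D1 u a j"
        by (simp add: e blinfun.bilinear_simps)
      have ip: "(a - z0) \<bullet> e = r * cos \<theta> * ((a - z0) \<bullet> h) + r * sin \<theta> * ((a - z0) \<bullet> j)"
        by (simp add: e inner_add_right)
      have s2: "(sin \<theta>)\<^sup>2 = 1 - (cos \<theta>)\<^sup>2" by (simp add: sin_squared_eq)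
      have c2: "cos (2 * \<theta>) = 2 * (cos \<theta>)\<^sup>2 - 1" by (simp add: cos_double_cos)
      have sc: "sin (2 * \<theta>) = 2 * sin \<theta> * cos \<theta>" by (rule sin_double)
      have "D2 u a e e = r\<^sup>2 * ((cos \<theta>)\<^sup>2 * D2 u a h h
          + sin \<theta> * cos \<theta> * (D2 u a h j + D2 u a j h) + (sin \<theta>)\<^sup>2 * D2 u a j j)"
        by (simp add: e blinfun.bilinear_simps power2_eq_square algebra_simps)
      also have "\<dots> / 2 = r\<^sup>2 / 4 * (D2 u a h h + D2 u a j j) + C * cos (2 * \<theta>) + D * sin (2 * \<theta>)"
        unfolding s2 c2 sc C_def D_def by (simp add: field_simps)
      also have "r\<^sup>2 / 4 * (D2 u a h h + D2 u a j j) = r\<^sup>2 * (levi_op u a h \<bullet> h)"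
        using D2_complex_line_trace[of u a h] by (simp add: j_def)
      also have "levi_op u a h \<bullet> h = c - 2 * \<eta>" by (simp add: \<eta>_def field_simps)
      finally have d2: "D2 u a e e / 2 = r\<^sup>2 * (c - 2 * \<eta>) + C * cos (2 * \<theta>) + D * sin (2 * \<theta>)" .
      show ?thesis
        unfolding d1 d2 ip K_def A_def B_def by (simp add: algebra_simps)
    qed
    finally show ?thesis by (simp add: e_def)
  qed
  then have "circle_mean v a (r *\<^sub>R h) \<le> ereal K" by (rule circle_mean_le_trigonometric)
  moreover have "v a \<le> circle_mean v a (r *\<^sub>R h)"
    using \<open>psh_on G v\<close> \<open>a \<in> G\<close> disc by (simp add: psh_on_def)
  ultimately have "v a \<le> ereal K" by simp
  then have "\<eta> * r\<^sup>2 \<le> 0" using eq by (simp add: K_def)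
  moreover have "\<eta> * r\<^sup>2 > 0" using \<open>\<eta> > 0\<close> r(1) by simp
  ultimately show False by simp
qed

theorem corollary4p9:
  fixes \<Omega> :: "'a::complex_hilbert_space set" and u :: "'a \<Rightarrow> real"
  assumes "\<nexists>B :: 'a set. finite B \<and> complex_vector.span B = UNIV"
    and "open \<Omega>"
    and "psh_on \<Omega> (\<lambda>z. ereal (u z))"
    and "C2_on \<Omega> u"
    and "\<And>G. G \<Subset> \<Omega> \<Longrightarrow>
           compact (closure {blinfun_apply (levi_op u z) h | z h. z \<in> G \<and> norm h \<le> 1})"
  shows "maximal_psh_on \<Omega> (\<lambda>z. ereal (u z))"
  unfolding maximal_psh_on_def
proof (intro conjI allI impI ballI)
  show "psh_on \<Omega> (\<lambda>z. ereal (u z))" by fact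
next
  fix G v z0
  assume "G \<Subset> \<Omega> \<and> psh_on G v \<and> (\<forall>\<xi>\<in>frontier G. Limsup (at \<xi> within G) v \<le> ereal (u \<xi>))"
    and z0: "z0 \<in> G"
  then have GO: "G \<Subset> \<Omega>" and v: "psh_on G v"
    and lim: "\<And>\<xi>. \<xi> \<in> frontier G \<Longrightarrow> Limsup (at \<xi> within G) v \<le> ereal (u \<xi>)" by auto
  have G: "open G" "bounded G" "closure G \<subseteq> \<Omega>" using GO by (auto simp: bounded_open_inside_def)
  have GO': "G \<subseteq> \<Omega>" using G(3) closure_subset by blast
  have v_fin: "v z < \<infinity>" if "z \<in> G" for z using v that by (simp add: psh_on_def)
  show "v z0 \<le> ereal (u z0)"
  proof (rule ccontr)
    assume "\<not> v z0 \<le> ereal (u z0)"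
    then have "ereal (u z0) < v z0" by simp
    then obtain V where V: "v z0 = ereal V" "u z0 < V"
      using v_fin[OF z0] by (cases "v z0") auto
    obtain R where R: "\<And>z. z \<in> closure G \<Longrightarrow> norm (z - z0) \<le> R"
      using bounded_closure[OF G(2)] unfolding bounded_any_center[of _ z0]
      by (metis dist_norm dist_commute)
    \<comment> \<open>Small enough that the boundary values \<open>2\<epsilon>R\<^sup>2\<close> stay below \<open>V - u z0\<close>.\<close>
    define \<epsilon> where "\<epsilon> = (V - u z0) / (4 * (R\<^sup>2 + 1))"
    have R1: "R\<^sup>2 + 1 > 0" using zero_le_power2[of R] by linarith
    have "\<epsilon> > 0" using V(2) R1 by (simp add: \<epsilon>_def)
    define c where "c = 2 * \<epsilon>"
    have "c * (R\<^sup>2 + 1) = (V - u z0) / 2" using R1 by (simp add: c_def \<epsilon>_def field_simps)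
    then have cR: "c * R\<^sup>2 < V - u z0"
      using \<open>\<epsilon> > 0\<close> V(2) by (simp add: c_def algebra_simps)
    obtain h where h: "norm h = 1" "\<And>z. z \<in> G \<Longrightarrow> levi_op u z h \<bullet> h \<le> \<epsilon>"
      using compact_operators_small_direction[OF assms(1) assms(5)[OF GO] \<open>\<epsilon> > 0\<close>] by blast
    define W where "W z = (if z \<in> G then v z + ereal (c * (norm (z - z0))\<^sup>2 - u z)
        else ereal (c * (norm (z - z0))\<^sup>2))" for z
    have u_cont: "continuous_on (closure G) u"
    proof (rule continuous_at_imp_continuous_on, rule ballI)
      fix x assume "x \<in> closure G"
      then have "x \<in> \<Omega>" using G(3) by blast
      then show "isCont u x"
        using assms(4) by (simp add: C2_on_def differentiable_imp_continuous_within)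
    qed
    have W_usc: "usc_on (closure G) W"
      unfolding W_def
    proof (rule usc_on_closure_extension[OF G(1) u_cont _ _ lim])
      show "continuous_on (closure G) (\<lambda>z. c * (norm (z - z0))\<^sup>2)"
        by (intro continuous_intros)
      show "usc_on G v" using v by (simp add: psh_on_def)
    qed
    \<comment> \<open>The slice of \<open>closure G\<close> by the complex line; as \<open>h\<close> is a unit vector, all of it has
      parameters in the disc of radius \<open>R\<close>.\<close>
    define K where "K = closure G \<inter> (\<lambda>\<zeta>. z0 + \<zeta> *\<^sub>C h) ` cball 0 R"
    have in_K: "z0 + \<zeta> *\<^sub>C h \<in> K" if "z0 + \<zeta> *\<^sub>C h \<in> closure G" for \<zeta>
    proof -
      have "\<zeta> \<in> cball 0 R" using R[OF that] h(1) by (simp add: norm_scaleC)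
      with that show ?thesis unfolding K_def by (intro IntI imageI)
    qed
    have "continuous_on (cball 0 R) (\<lambda>\<zeta>. z0 + \<zeta> *\<^sub>C h)"
      by (intro continuous_on_add continuous_on_const linear_continuous_on
          bounded_linear_scaleC_left)
    then have "compact K"
      unfolding K_def
      by (intro closed_Int_compact compact_continuous_image closed_closure compact_cball)
    moreover have z0K: "z0 \<in> K" using in_K[of 0] subsetD[OF closure_subset z0] by simp
    moreover have "usc_on K W" using W_usc by (rule usc_on_subset) (auto simp: K_def)
    ultimately obtain a where a: "a \<in> K" "\<And>z. z \<in> K \<Longrightarrow> W z \<le> W a"
      using usc_on_attains_max[of K W] by blast
    have "W z0 = ereal (V - u z0)" using z0 V(1) by (simp add: W_def)
    then have Wa: "ereal (V - u z0) \<le> W a" using a(2)[OF z0K] by simp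
    have aG: "a \<in> G"
    proof (rule ccontr)
      assume "a \<notin> G"
      then have "V - u z0 \<le> c * (norm (a - z0))\<^sup>2" using Wa by (simp add: W_def)
      also have "\<dots> \<le> c * R\<^sup>2"
      proof (intro mult_left_mono power_mono)
        show "norm (a - z0) \<le> R" using R a(1) by (simp add: K_def)
      qed (use \<open>\<epsilon> > 0\<close> in \<open>simp_all add: c_def\<close>)
      finally show False using cR by simp
    qed
    obtain \<alpha> where \<alpha>: "v a = ereal \<alpha>"
      using Wa v_fin[OF aG] aG by (cases "v a") (auto simp: W_def)
    define m where "m = \<alpha> + c * (norm (a - z0))\<^sup>2 - u a"
    have Wa_m: "W a = ereal m" using aG \<alpha> by (simp add: W_def m_def)
    obtain \<zeta>\<^sub>a where \<zeta>\<^sub>a: "a = z0 + \<zeta>\<^sub>a *\<^sub>C h" using a(1) unfolding K_def by blast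
    show False
    proof (rule psh_on_not_touched_from_above[OF assms(2,4) G(1) GO' v aG h(1)])
      show "levi_op u a h \<bullet> h < c" using h(2)[OF aG] \<open>\<epsilon> > 0\<close> by (simp add: c_def)
      show "v a = ereal (m + u a - c * (norm (a - z0))\<^sup>2)" by (simp add: \<alpha> m_def)
    next
      fix \<zeta> assume w: "a + \<zeta> *\<^sub>C h \<in> G"
      let ?w = "a + \<zeta> *\<^sub>C h"
      have "?w = z0 + (\<zeta>\<^sub>a + \<zeta>) *\<^sub>C h" by (simp add: \<zeta>\<^sub>a scaleC_add_left add.assoc)
      then have "?w \<in> K" using in_K[of "\<zeta>\<^sub>a + \<zeta>"] subsetD[OF closure_subset w] by simp
      then have "v ?w + ereal (c * (norm (?w - z0))\<^sup>2 - u ?w) \<le> ereal m"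
        using a(2)[of ?w] w Wa_m by (simp add: W_def)
      then show "v ?w \<le> ereal (m + u ?w - c * (norm (?w - z0))\<^sup>2)"
        by (cases "v ?w") auto
    qed
  qed
qed

end
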